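(* Let $(U,\varphi)$ be a structured chart in a metric measure space $(X,d,\mu)$, $S\subset U$ Borel and $L,\beta>0$. Suppose that there exists a sequence of $L$-Lipschitz functions $f_m\colon X\to\mathbb R$ ($m\in\mathbb N$) such that: \begin{enumerate} \item For every $x_0\in S$ there exists an $M\in\mathbb N$ such that, for each $m\ge M$, there exists an $x\in X$ with $0<d(x,x_0)<1/m$ and $|f_m(x)-f_m(x_0)|\ge\beta d(x,x_0)$. \item For every $m\in\mathbb N$ there exists a $\rho_m>0$ such that, for every $x_0\in S$ and any $y,z\in B(x_0,\rho_m)$, $|f_m(y)-f_m(z)|\le d(y,z)/m$. \end{enumerate} Then there exists a Lipschitz function $F\colon X\to\mathbb R$ that is differentiable (with respect to $(U,\varphi)$) $\mu$-almost nowhere on $S$. In particular, if $X$ is a Lipschitz differentiability space, then $S$ is $\mu$-null.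
   Context: Metric measure space: $(X,d)$ is a complete separable metric space, $\mu$ a finite Borel regular measure on $X$, and the set of isolated points of $X$ is $\mu$-null. $B(x,r)$ denotes the open ball. Charts: a Borel set $U\subset X$ and a Lipschitz $\varphi\colon X\to\mathbb R^n$ ($n\in\mathbb N$) form an $n$-dimensional chart $(U,\varphi)$. A function $f\colon X\to\mathbb R$ is differentiable at $x_0\in U$ with respect to $(U,\varphi)$ if there is a unique $Df(x_0)\in\mathbb R^n$ with $\limsup_{X\ni x\to x_0}|f(x)-f(x_0)-Df(x_0)\cdot(\varphi(x)-\varphi(x_0))|/d(x,x_0)=0$. $(X,d,\mu)$ is a Lipschitz differentiability space if $X$ has a countable decomposition into charts such that every Lipschitz $f\colon X\to\mathbb R$ is differentiable at $\mu$-almost every point of every chart. Structured charts: for $\lambda>0$, $U\subset X$ and a Lipschitz $\varphi\colon X\to\mathbb R^n$ form a $\lambda$-structured chart of dimension $n$ if $U$ is compact and there is $U'\subset U$ of full measure such that, for every $R>0$, there exists $r>0$ such that for every $x_0\in U'$ there are $x_1,\dots,x_n\in U$ with $r<d(x_i,x_0)<R$ for each $i$ and $\max_{1\le i\le n}|(\varphi(x_i)-\varphi(x_0))\cdot v|/d(x_i,x_0)\ge\lambda$ for every $v\in\mathbb S^{n-1}$. It is a structured chart if it is a $\lambda$-structured chart for some $\lambda>0$. *)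

theory Defs
  imports "HOL-Analysis.Analysis"
begin

text \<open>The space X is the universe of a type of class \<^class>\<open>polish_space\<close>, that is, a complete
  separable metric space.  A finite Borel regular (outer) measure is determined by its restriction
  to the Borel sets, which is what is represented here; a possibly non-Borel set is null for the
  outer measure iff it is contained in a Borel null set, which is what \<open>AE\<close>
  quantification expresses.\<close>

locale metric_measure_space = finite_measure M
  for M :: "'a :: polish_space measure" +
  assumes sets_eq_borel: "sets M = sets borel"
    and isolated_null: "{x. x isolated_in UNIV} \<in> null_sets M"

text \<open>The dimension \<open>n\<close> varies from chart to chart within a single statement, so a point of
  \<open>\<real>\<^sup>n\<close> is given by a function \<^typ>\<open>nat \<Rightarrow> real\<close> of which only the coordinates
  \<open>i < n\<close> are ever used.\<close>

definition dotn :: "nat \<Rightarrow> (nat \<Rightarrow> real) \<Rightarrow> (nat \<Rightarrow> real) \<Rightarrow> real" where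
  "dotn n v w = (\<Sum>i<n. v i * w i)"

definition normn :: "nat \<Rightarrow> (nat \<Rightarrow> real) \<Rightarrow> real" where
  "normn n v = L2_set v {..<n}"

definition diffn :: "(nat \<Rightarrow> real) \<Rightarrow> (nat \<Rightarrow> real) \<Rightarrow> nat \<Rightarrow> real" where
  "diffn v w = (\<lambda>i. v i - w i)"

definition Lipschitz :: "('a :: metric_space \<Rightarrow> real) \<Rightarrow> bool" where
  "Lipschitz f \<longleftrightarrow> (\<exists>C. C-lipschitz_on UNIV f)"

definition Lipschitzn :: "nat \<Rightarrow> ('a :: metric_space \<Rightarrow> nat \<Rightarrow> real) \<Rightarrow> bool" where
  "Lipschitzn n \<phi> \<longleftrightarrow> (\<exists>C\<ge>0. \<forall>x y. normn n (diffn (\<phi> x) (\<phi> y)) \<le> C * dist x y)"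

definition chart :: "nat \<Rightarrow> 'a :: metric_space set \<Rightarrow> ('a \<Rightarrow> nat \<Rightarrow> real) \<Rightarrow> bool" where
  "chart n U \<phi> \<longleftrightarrow> U \<in> sets borel \<and> Lipschitzn n \<phi>"

text \<open>Restricting \<open>D\<close> to \<^term>\<open>extensional {..<n}\<close> makes \<open>\<exists>!\<close> express uniqueness
  in \<open>\<real>\<^sup>n\<close>.\<close>

definition differentiable_wrt ::
    "nat \<Rightarrow> 'a :: metric_space set \<Rightarrow> ('a \<Rightarrow> nat \<Rightarrow> real) \<Rightarrow> ('a \<Rightarrow> real) \<Rightarrow> 'a \<Rightarrow> bool" where
  "differentiable_wrt n U \<phi> f x0 \<longleftrightarrow> x0 \<in> U \<and>
     (\<exists>!D. D \<in> extensional {..<n} \<and>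
        Limsup (at x0)
          (\<lambda>x. ereal (\<bar>f x - f x0 - dotn n D (diffn (\<phi> x) (\<phi> x0))\<bar> / dist x x0)) = 0)"

definition lipschitz_differentiability_space :: "'a :: polish_space measure \<Rightarrow> bool" where
  "lipschitz_differentiability_space M \<longleftrightarrow> metric_measure_space M \<and>
     (\<exists>(n :: nat \<Rightarrow> nat) (U :: nat \<Rightarrow> 'a set) (\<phi> :: nat \<Rightarrow> 'a \<Rightarrow> nat \<Rightarrow> real).
        (\<forall>j. chart (n j) (U j) (\<phi> j)) \<and> disjoint_family U \<and> (\<Union>j. U j) = UNIV \<and>
        (\<forall>f. Lipschitz f \<longrightarrow>
           (\<forall>j. AE x in M. x \<in> U j \<longrightarrow> differentiable_wrt (n j) (U j) (\<phi> j) f x)))"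

text \<open>For \<open>n = 0\<close> there is no \<open>v\<close> with \<^term>\<open>normn n v = 1\<close>, so the maximum is only
  ever taken over a nonempty set.\<close>

definition lambda_structured_chart ::
    "'a :: metric_space measure \<Rightarrow> real \<Rightarrow> nat \<Rightarrow> 'a set \<Rightarrow> ('a \<Rightarrow> nat \<Rightarrow> real) \<Rightarrow> bool" where
  "lambda_structured_chart M \<kappa> n U \<phi> \<longleftrightarrow> \<kappa> > 0 \<and> Lipschitzn n \<phi> \<and> compact U \<and>
     (\<exists>U' \<subseteq> U. (AE x in M. x \<in> U \<longrightarrow> x \<in> U') \<and>
        (\<forall>R>0. \<exists>r>0. \<forall>x0\<in>U'. \<exists>x :: nat \<Rightarrow> 'a.
           (\<forall>i<n. x i \<in> U \<and> r < dist (x i) x0 \<and> dist (x i) x0 < R) \<and>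
           (\<forall>v. normn n v = 1 \<longrightarrow>
              (MAX i\<in>{..<n}. \<bar>dotn n (diffn (\<phi> (x i)) (\<phi> x0)) v\<bar> / dist (x i) x0) \<ge> \<kappa>)))"

definition structured_chart ::
    "'a :: metric_space measure \<Rightarrow> nat \<Rightarrow> 'a set \<Rightarrow> ('a \<Rightarrow> nat \<Rightarrow> real) \<Rightarrow> bool" where
  "structured_chart M n U \<phi> \<longleftrightarrow> (\<exists>\<kappa>>0. lambda_structured_chart M \<kappa> n U \<phi>)"

end

theory Submission
  imports Defs
begin

text \<open>The function \<open>F\<close> is a lacunary sum of the \<open>f m\<close>.  Pass to a very sparse
  subsequence and make its \<open>k\<close>-th member small in amplitude without destroying its oscillation, to
  get functions \<open>g k \<ge> 0\<close> and scales \<open>\<delta> 0 \<ge> \<rho> 0 > \<delta> 1 \<ge> \<rho> 1 > \<dots>\<close> such that, seen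
  from a point \<open>s\<close> of \<open>S\<close>, the function \<open>g k\<close> has slope at most \<open>e k\<close> at distances below \<open>\<rho> k\<close> (by
  hypothesis on \<open>f m\<close>) and at distances above \<open>\<delta> k\<close> (because it is at most \<open>e k * \<delta> k\<close>),
  where \<open>\<Sum>k. e k\<close> is as small as desired.  Since the intervals \<open>[\<rho> k, \<delta> k)\<close> are disjoint, at
  each distance from \<open>s\<close> at most one \<open>g k\<close> is not nearly constant.  So a sum \<open>F\<close> of \<open>g k\<close>'s has slope
  almost \<open>\<beta>\<close> at a suitable point with distance to \<open>s\<close> in \<open>[\<rho> k, \<delta> k)\<close>, and almost vanishing
  slope at all distances in the gap from \<open>\<delta> (Suc k)\<close> to \<open>\<rho> k\<close>.  If each \<open>g k\<close> is in
  addition cut off away from \<open>S\<close>, then for any pair of points, near \<open>S\<close> or not, all but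
  one of the \<open>g k\<close> have slope at most \<open>e k\<close>; hence \<open>F\<close> is Lipschitz on the whole space.  The abstract
  situation is the locale \<open>lacunary_family\<close>; it is realised in \<open>exists_lacunary_family\<close>.

  The amplitude is made small by composing \<open>f m\<close> with a triangle wave.  Folding may destroy the
  oscillation at the points that are sent close to a corner of the wave, but among \<open>2 ^ k\<close> shifts of
  the wave one spoils only a set of measure at most \<open>\<mu>(X) / 2 ^ k\<close>, and by Borel--Cantelli almost every
  point is spoilt only finitely often.

  Nondifferentiability with respect to a structured chart: the scales can be chosen so that the
  points provided by the chart lie in the gaps.  A derivative \<open>D\<close> of \<open>F\<close> at \<open>s\<close> is almost zero when
  tested with these points, so \<open>D\<close> is small; but then \<open>F\<close> cannot have slope near \<open>\<beta>\<close> at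
  arbitrarily small distances.

  The charts of a Lipschitz differentiability space are unrelated to \<open>(U, \<phi>)\<close>, so the
  function \<open>F\<close> by itself does not settle the second claim, but the same family does: for
  \<open>n\<close>-dimensional charts, split the family into the \<open>n + 1\<close> sums \<open>F i\<close> over the residue classes
  \<open>k mod (n + 1) = i\<close>.  If all of them had derivatives at \<open>s\<close>, these \<open>n + 1\<close>
  vectors of \<open>\<real>\<^sup>n\<close> would satisfy a nontrivial linear relation \<open>\<Sum>i. c i * D i = 0\<close>, so that
  \<open>\<Sum>i. c i * F i\<close> would have derivative \<open>0\<close> at \<open>s\<close>.  But for \<open>i\<close> with \<open>\<bar>c i\<bar>\<close> maximal and
  large \<open>k\<close> in the \<open>i\<close>-th class, this combination has slope almost \<open>\<bar>c i\<bar> * \<beta>\<close> at the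
  scale of \<open>g k\<close>.  Thus almost every point of \<open>S\<close> is a point of nondifferentiability for one of \<open>n + 1\<close>
  functions, whatever the chart.\<close>

section \<open>Linear dependence\<close>

text \<open>Gaussian elimination: a vector \<open>D p\<close> with nonzero last coordinate clears that coordinate from the
  remaining vectors.\<close>

lemma linear_dependence:
  fixes D :: "'i \<Rightarrow> nat \<Rightarrow> real"
  assumes "finite I" "n < card I"
  shows "\<exists>c. (\<exists>i\<in>I. c i \<noteq> 0) \<and> (\<forall>l<n. (\<Sum>i\<in>I. c i * D i l) = 0)"
  using assms
proof (induction n arbitrary: I D)
  case 0
  then have "I \<noteq> {}" by auto
  then show ?case by (intro exI[of _ "\<lambda>_. 1"]) auto
next
  case (Suc n)
  show ?case
  proof (cases "\<forall>i\<in>I. D i n = 0")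
    case True
    obtain c where "\<exists>i\<in>I. c i \<noteq> 0" "\<forall>l<n. (\<Sum>i\<in>I. c i * D i l) = 0"
      using Suc.IH[of I D] Suc.prems by auto
    with True show ?thesis by (intro exI[of _ c]) (auto simp: less_Suc_eq)
  next
    case False
    then obtain p where p: "p \<in> I" "D p n \<noteq> 0" by blast
    define J where "J = I - {p}"
    define E where "E = (\<lambda>i l. D i l - D i n / D p n * D p l)"
    have "finite J" "n < card J" using Suc.prems p by (auto simp: J_def)
    then obtain c where c: "\<exists>i\<in>J. c i \<noteq> 0" "\<And>l. l < n \<Longrightarrow> (\<Sum>i\<in>J. c i * E i l) = 0"
      using Suc.IH[of J E] by blast
    define c' where "c' = c(p := - (\<Sum>i\<in>J. c i * D i n) / D p n)"
    have split: "(\<Sum>i\<in>I. c' i * D i l) = (\<Sum>i\<in>J. c i * E i l)" for l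
    proof -
      have "(\<Sum>i\<in>I. c' i * D i l) = c' p * D p l + (\<Sum>i\<in>J. c' i * D i l)"
        unfolding J_def using Suc.prems p by (intro sum.remove) auto
      also have "(\<Sum>i\<in>J. c' i * D i l) = (\<Sum>i\<in>J. c i * D i l)"
        by (intro sum.cong) (auto simp: c'_def J_def)
      also have "c' p * D p l = - (\<Sum>i\<in>J. c i * (D i n / D p n * D p l))"
        by (simp add: c'_def sum_distrib_right sum_divide_distrib sum_negf[symmetric] mult.assoc)
      finally show ?thesis by (simp add: E_def right_diff_distrib sum_subtractf)
    qed
    have "(\<Sum>i\<in>I. c' i * D i l) = 0" if "l < Suc n" for l
      using that c(2) p(2) by (cases "l = n") (auto simp: split E_def)
    moreover have "\<exists>i\<in>I. c' i \<noteq> 0"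
      using c(1) by (auto simp: c'_def J_def)
    ultimately show ?thesis by blast
  qed
qed

section \<open>Folding a function into a short interval\<close>

text \<open>The wave with period \<open>2\<close>, corners exactly at the integers, and slopes \<open>\<plusminus>1\<close>.\<close>

definition triangle_wave :: "real \<Rightarrow> real" where
  "triangle_wave t = infdist t (range (\<lambda>z. 2 * of_int z))"

lemma triangle_wave_eq:
  assumes "\<bar>t - 2 * of_int z\<bar> \<le> 1"
  shows "triangle_wave t = \<bar>t - 2 * of_int z\<bar>"
proof -
  have "\<bar>t - 2 * of_int z\<bar> \<le> \<bar>t - 2 * of_int z'\<bar>" for z' :: int
  proof (cases "z' = z")
    case False
    then have "1 \<le> \<bar>z' - z\<bar>" by simp
    then have "(1::real) \<le> \<bar>of_int z' - of_int z\<bar>"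
      by linarith
    with assms show ?thesis by linarith
  qed simp
  then have "\<bar>t - 2 * of_int z\<bar> \<le> triangle_wave t"
    unfolding triangle_wave_def
    by (auto simp: infdist_notempty dist_real_def intro!: cINF_greatest)
  moreover have "triangle_wave t \<le> \<bar>t - 2 * of_int z\<bar>"
    unfolding triangle_wave_def dist_real_def[symmetric] by (rule infdist_le) auto
  ultimately show ?thesis by simp
qed

lemma triangle_wave_Lipschitz: "\<bar>triangle_wave s - triangle_wave t\<bar> \<le> \<bar>s - t\<bar>"
  unfolding triangle_wave_def by (metis infdist_triangle_abs dist_real_def)

lemma triangle_wave_bounds: "0 \<le> triangle_wave t" "triangle_wave t \<le> 1"
proof -
  have "\<bar>t - 2 * of_int \<lfloor>t / 2 + 1 / 2\<rfloor>\<bar> \<le> 1" by linarith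
  from triangle_wave_eq[OF this] this show "triangle_wave t \<le> 1" by simp
qed (simp add: triangle_wave_def infdist_nonneg)

lemma triangle_wave_isometry:
  assumes "of_int k \<le> s" "s \<le> of_int k + 1" "of_int k \<le> t" "t \<le> of_int k + 1"
  shows "\<bar>triangle_wave s - triangle_wave t\<bar> = \<bar>s - t\<bar>"
proof -
  consider z where "k = 2 * z" | z where "k = 2 * z - 1"
    by (metis add_diff_cancel_right' evenE oddE diff_add_cancel even_diff odd_one)
  then show ?thesis
  proof cases
    case 1
    then show ?thesis using assms triangle_wave_eq[of s z] triangle_wave_eq[of t z] by auto
  next
    case 2
    then show ?thesis using assms triangle_wave_eq[of s z] triangle_wave_eq[of t z] by auto
  qed
qed

text \<open>The wave \<open>h\<close> obtained from \<open>f\<close> has its corners at the values \<open>(N * q + i) * u\<close>, \<open>q \<in> \<int>\<close>, with a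
  shift \<open>i < N\<close> to be chosen.  Folding is harmless at \<open>y\<close> unless \<open>f y\<close> is within \<open>u / 2\<close> of a corner,
  that is, unless \<open>f y / u\<close> rounds to an integer congruent to \<open>i\<close> modulo \<open>N\<close>.  This happens for only
  one of the \<open>N\<close> shifts, so on average a shift is harmful on a fraction \<open>1 / N\<close> of the space.\<close>

lemma fold_isometrically_off_small_set:
  fixes f :: "'a \<Rightarrow> real" and u :: real and N :: nat
  assumes "finite_measure M" and [measurable]: "f \<in> borel_measurable M" and "0 < u" and "1 \<le> N"
  obtains h B where "B \<in> sets M" "measure M B \<le> measure M (space M) / N"
    "\<And>x. 0 \<le> h x" "\<And>x. h x \<le> N * u" "\<And>x y. \<bar>h x - h y\<bar> \<le> \<bar>f x - f y\<bar>"
    "\<And>x y. y \<in> space M - B \<Longrightarrow> \<bar>f x - f y\<bar> < u / 2 \<Longrightarrow> \<bar>h x - h y\<bar> = \<bar>f x - f y\<bar>"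
proof -
  interpret finite_measure M by fact
  define B where "B i = {x \<in> space M. \<lfloor>f x / u + 1 / 2\<rfloor> mod int N = int i}" for i
  have B: "B i \<in> sets M" for i
    unfolding B_def by measurable
  have "(\<Sum>i<N. measure M (B i)) = measure M (\<Union>i<N. B i)"
    by (intro finite_measure_finite_Union[symmetric])
      (auto simp: B disjoint_family_on_def B_def)
  also have "\<dots> \<le> measure M (space M)"
    by (rule bounded_measure)
  finally have sum_le: "(\<Sum>i<N. measure M (B i)) \<le> measure M (space M)" .
  have "\<exists>i<N. measure M (B i) \<le> measure M (space M) / N"
  proof (rule ccontr)
    assume "\<not> ?thesis"
    then have "(\<Sum>i<N. measure M (space M) / N) < (\<Sum>i<N. measure M (B i))"
      using assms by (intro sum_strict_mono) (auto simp: not_le lessThan_empty_iff)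
    with sum_le show False using assms by simp
  qed
  then obtain i where i: "i < N" "measure M (B i) \<le> measure M (space M) / N" by blast
  define a where "a x = (f x / u - i) / N" for x
  define h where "h x = N * u * triangle_wave (a x)" for x
  have pos: "0 < N * u" using assms by simp
  have a_diff: "N * u * \<bar>a x - a y\<bar> = \<bar>f x - f y\<bar>" for x y
  proof -
    have "f x - f y = N * u * (a x - a y)" using assms by (simp add: a_def field_simps)
    then show ?thesis using assms(3) by (simp add: abs_mult)
  qed
  have h_diff: "\<bar>h x - h y\<bar> = N * u * \<bar>triangle_wave (a x) - triangle_wave (a y)\<bar>" for x y
    using assms(3) by (simp add: h_def right_diff_distrib[symmetric] abs_mult)
  show ?thesis
  proof (rule that[of "B i" h])
    show "0 \<le> h x" "h x \<le> N * u" for x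
      using triangle_wave_bounds[of "a x"] pos mult_left_mono[of "triangle_wave (a x)" 1 "N * u"] by (auto simp: h_def)
    show "\<bar>h x - h y\<bar> \<le> \<bar>f x - f y\<bar>" for x y
      unfolding h_diff a_diff[symmetric] using pos by (intro mult_left_mono triangle_wave_Lipschitz) auto
    show "\<bar>h x - h y\<bar> = \<bar>f x - f y\<bar>" if y: "y \<in> space M - B i" and xy: "\<bar>f x - f y\<bar> < u / 2" for x y
    proof -
      define k where "k = \<lfloor>a y\<rfloor>"
      have no_corner: "\<lfloor>f y / u + 1 / 2\<rfloor> \<noteq> int N * q + int i" for q
        using y i(1) by (auto simp: B_def)
      have near: "\<bar>f x / u - f y / u\<bar> < 1 / 2"
        using xy assms(3) by (simp add: diff_divide_distrib[symmetric] abs_divide field_simps)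
      have corner: "a z \<le> of_int q \<longleftrightarrow> f z / u \<le> of_int (int N * q + int i)"
        "of_int q \<le> a z \<longleftrightarrow> of_int (int N * q + int i) \<le> f z / u" for z and q :: int
        using assms by (simp_all add: a_def field_simps)
      have y_k: "of_int k \<le> a y" "a y < of_int k + 1" by (auto simp: k_def)
      have "a x \<le> of_int (k + 1)"
      proof (rule ccontr)
        assume "\<not> ?thesis"
        then have "f y / u \<le> of_int (int N * (k + 1) + int i)" "of_int (int N * (k + 1) + int i) < f x / u"
          using y_k corner(1)[of x "k + 1"] corner(1)[of y "k + 1"] by auto
        then have "\<lfloor>f y / u + 1 / 2\<rfloor> = int N * (k + 1) + int i"
          using near by (intro floor_unique) linarith+
        then show False using no_corner by blast
      qed
      moreover have "of_int k \<le> a x"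
      proof (rule ccontr)
        assume "\<not> ?thesis"
        then have "of_int (int N * k + int i) \<le> f y / u" "f x / u < of_int (int N * k + int i)"
          using y_k corner(2)[of k x] corner(2)[of k y] by auto
        then have "\<lfloor>f y / u + 1 / 2\<rfloor> = int N * k + int i"
          using near by (intro floor_unique) linarith+
        then show False using no_corner by blast
      qed
      ultimately show ?thesis
        using y_k by (simp add: h_diff a_diff[symmetric] triangle_wave_isometry[of k])
    qed
  qed (use B i in auto)
qed


section \<open>Lacunary families\<close>

definition steep :: "('a :: metric_space \<Rightarrow> real) \<Rightarrow> real \<Rightarrow> real \<Rightarrow> 'a \<Rightarrow> 'a \<Rightarrow> bool" where
  "steep h r \<beta> s x \<longleftrightarrow> 0 < dist x s \<and> dist x s < r \<and> \<beta> * dist x s \<le> \<bar>h x - h s\<bar>"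

text \<open>\<open>near_S\<close> is what controls pairs of points away from \<open>S\<close>, where the flatness
  at scales below \<open>\<rho> k\<close> says nothing.  The factor \<open>2\<close> in \<open>next_scale\<close> leaves room
  for a triangle inequality in \<open>all_but_one_flat\<close>.\<close>

locale lacunary_family =
  fixes S :: "'a :: metric_space set" and g :: "nat \<Rightarrow> 'a \<Rightarrow> real"
    and \<delta> \<rho> e :: "nat \<Rightarrow> real" and C :: real
  assumes inner_pos: "0 < \<rho> k" and inner_le: "\<rho> k \<le> \<delta> k" and next_scale: "2 * \<delta> (Suc k) \<le> \<rho> k"
    and e_nonneg: "0 \<le> e k" and e_summable: "summable e"
    and nonneg: "0 \<le> g k x" and small: "g k x \<le> e k * \<delta> k"
    and near_S: "g k x \<noteq> 0 \<Longrightarrow> \<exists>s\<in>S. dist x s < \<delta> k"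
    and Lip: "\<bar>g k y - g k z\<bar> \<le> C * dist y z"
    and flat: "s \<in> S \<Longrightarrow> y \<in> ball s (\<rho> k) \<Longrightarrow> z \<in> ball s (\<rho> k) \<Longrightarrow> \<bar>g k y - g k z\<bar> \<le> e k * dist y z"
begin

lemma scale_pos: "0 < \<delta> k"
  using inner_pos[of k] inner_le[of k] by linarith

lemma scale_halves: "2 * \<delta> (Suc k) \<le> \<delta> k"
  using inner_le[of k] next_scale[of k] by linarith

lemma later_scale: "j < k \<Longrightarrow> 2 * \<delta> k \<le> \<rho> j"
proof (induction k)
  case (Suc k)
  then show ?case
    using next_scale[of j] scale_halves[of k] scale_pos[of "Suc k"] by (cases "j = k") auto
qed simp

lemma scale_bound: "\<delta> k \<le> \<delta> 0 * (1 / 2) ^ k"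
proof (induction k)
  case (Suc k)
  then show ?case using scale_halves[of k] by simp
qed simp

lemma scales_vanish: "0 < \<tau> \<Longrightarrow> \<exists>K. \<forall>k\<ge>K. \<delta> k < \<tau>"
proof -
  assume \<tau>: "0 < \<tau>"
  have "(\<lambda>k. \<delta> 0 * (1 / 2) ^ k) \<longlonglongrightarrow> \<delta> 0 * 0"
    by (intro tendsto_mult_left LIMSEQ_realpow_zero) auto
  then have "\<forall>\<^sub>F k in sequentially. \<delta> 0 * (1 / 2) ^ k < \<tau>"
    using \<tau> by (auto dest: order_tendstoD(2))
  then have "\<forall>\<^sub>F k in sequentially. \<delta> k < \<tau>"
    by eventually_elim (rule le_less_trans[OF scale_bound])
  then show ?thesis by (simp add: eventually_sequentially)
qed

lemma e_le_suminf: "e k \<le> suminf e"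
  using sum_le_suminf[OF e_summable, of "{k}"] e_nonneg by simp

lemma diff_small: "\<bar>g k y - g k z\<bar> \<le> e k * \<delta> k"
  using nonneg[of k y] nonneg[of k z] small[of k y] small[of k z] by linarith

lemma coarse_flat: "\<delta> k \<le> dist y z \<Longrightarrow> \<bar>g k y - g k z\<bar> \<le> e k * dist y z"
  using diff_small[of k y z] mult_left_mono[OF _ e_nonneg[of k], of "\<delta> k" "dist y z"] by linarith

lemma flat_at_S:
  assumes "s \<in> S" "dist x s < \<rho> k \<or> \<delta> k \<le> dist x s"
  shows "\<bar>g k x - g k s\<bar> \<le> e k * dist x s"
  using assms flat[of s x k s] inner_pos[of k] coarse_flat[of k x s] by (auto simp: dist_commute)

text \<open>The exceptional index \<open>k\<close> is the first one for which the pair does not fit into a ball of radius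
  \<open>\<rho> k\<close> about a point of \<open>S\<close>.  Functions with a smaller index are flat on the pair.  A
  function with a larger index \<open>j\<close> vanishes at both points unless one of them is within \<open>\<delta> j\<close> of some
  \<open>s \<in> S\<close>; the other one is then at distance at least \<open>\<rho> k \<ge> 2 * \<delta> j\<close> from \<open>s\<close>, so the
  distance of the pair is at least \<open>\<delta> j\<close>, a scale at which \<open>g j\<close> is flat by smallness.\<close>

lemma all_but_one_flat:
  obtains k where "\<And>j. j \<noteq> k \<Longrightarrow> \<bar>g j y - g j z\<bar> \<le> e j * dist y z"
proof (cases "\<forall>k. \<exists>s\<in>S. y \<in> ball s (\<rho> k) \<and> z \<in> ball s (\<rho> k)")
  case True
  then have "\<bar>g j y - g j z\<bar> \<le> e j * dist y z" for j
    using flat by blast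
  then show ?thesis by (rule that)
next
  case False
  define k where "k = (LEAST k. \<not> (\<exists>s\<in>S. y \<in> ball s (\<rho> k) \<and> z \<in> ball s (\<rho> k)))"
  have k: "\<not> (\<exists>s\<in>S. y \<in> ball s (\<rho> k) \<and> z \<in> ball s (\<rho> k))"
    unfolding k_def using False by (intro LeastI_ex[of "\<lambda>k. \<not> (\<exists>s\<in>S. y \<in> ball s (\<rho> k) \<and> z \<in> ball s (\<rho> k))"]) (simp only: not_all)
  have before: "\<exists>s\<in>S. y \<in> ball s (\<rho> j) \<and> z \<in> ball s (\<rho> j)" if "j < k" for j
    using not_less_Least[of j] that unfolding k_def by blast
  show ?thesis
  proof (rule that[of k])
    fix j assume "j \<noteq> k"
    then consider "j < k" | "k < j" by linarith
    then show "\<bar>g j y - g j z\<bar> \<le> e j * dist y z"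
    proof cases
      case 1
      then show ?thesis using before flat by blast
    next
      case 2
      note later = later_scale[OF 2]
      have far: "\<delta> j \<le> dist x x'"
        if "s \<in> S" "dist x s < \<delta> j" "\<not> (x \<in> ball s (\<rho> k) \<and> x' \<in> ball s (\<rho> k))" for x x' s
        using that later scale_pos[of j] dist_triangle[of s x' x] by (auto simp: dist_commute)
      show ?thesis
      proof (cases "g j y = 0 \<and> g j z = 0")
        case False
        then consider s where "s \<in> S" "dist y s < \<delta> j" | s where "s \<in> S" "dist z s < \<delta> j"
          using near_S[of j y] near_S[of j z] by blast
        then have "\<delta> j \<le> dist y z"
          using far[of _ y z] far[of _ z y] k by cases (auto simp: dist_commute[of z y])
        then show ?thesis by (rule coarse_flat)
      qed (simp add: e_nonneg)
    qed
  qed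
qed

definition superposition :: "nat set \<Rightarrow> 'a \<Rightarrow> real" where
  "superposition A x = (\<Sum>k. if k \<in> A then g k x else 0)"

lemma superposition_summable: "summable (\<lambda>k. if k \<in> A then g k x else 0)"
proof (rule summable_comparison_test)
  have "g k x \<le> \<delta> 0 * e k" for k
  proof -
    have "\<delta> k \<le> \<delta> 0"
      using later_scale[of 0 k] inner_le[of 0] scale_pos[of k] by (cases "k = 0") auto
    then show ?thesis
      using small[of k x] mult_left_mono[OF _ e_nonneg[of k], of "\<delta> k" "\<delta> 0"] by (simp add: mult.commute)
  qed
  then show "\<exists>N. \<forall>k\<ge>N. norm (if k \<in> A then g k x else 0) \<le> \<delta> 0 * e k"
    using nonneg e_nonneg scale_pos[of 0] by (auto intro!: exI[of _ 0] mult_nonneg_nonneg)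
  show "summable (\<lambda>k. \<delta> 0 * e k)" by (intro summable_mult e_summable)
qed

lemma superposition_flat:
  assumes "\<And>k. k \<in> A \<Longrightarrow> \<bar>g k y - g k z\<bar> \<le> e k * dist y z"
  shows "\<bar>superposition A y - superposition A z\<bar> \<le> suminf e * dist y z"
proof -
  let ?t = "\<lambda>k. (if k \<in> A then g k y else 0) - (if k \<in> A then g k z else 0)"
  have le: "norm (?t k) \<le> e k * dist y z" for k
    using assms[of k] e_nonneg by auto
  have sm: "summable (\<lambda>k. e k * dist y z)" by (intro summable_mult2 e_summable)
  have "superposition A y - superposition A z = suminf ?t"
    unfolding superposition_def by (intro suminf_diff superposition_summable)
  also have "norm \<dots> \<le> (\<Sum>k. e k * dist y z)"
    using norm_suminf_le[OF le sm] .
  finally show ?thesis using suminf_mult2[OF e_summable, of "dist y z"] by simp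
qed

lemma superposition_remove:
  "k \<in> A \<Longrightarrow> superposition A x = g k x + superposition (A - {k}) x"
proof -
  assume k: "k \<in> A"
  have "superposition A x = (\<Sum>j. (if j = k then g k x else 0) + (if j \<in> A - {k} then g j x else 0))"
    unfolding superposition_def using k by (intro suminf_cong) auto
  also have "\<dots> = (\<Sum>j. if j = k then g k x else 0) + superposition (A - {k}) x"
    unfolding superposition_def by (intro suminf_add[symmetric] superposition_summable summable_single)
  also have "(\<Sum>j. if j = k then g k x else 0) = g k x"
    using sums_single[of k "\<lambda>_. g k x"] by (simp add: sums_iff)
  finally show ?thesis .
qed

lemma superposition_Lipschitz: "Lipschitz (superposition A)"
proof -
  have E: "0 \<le> suminf e" using e_nonneg e_summable by (intro suminf_nonneg)
  have "\<bar>superposition A y - superposition A z\<bar> \<le> (\<bar>C\<bar> + suminf e) * dist y z" for y z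
  proof -
    obtain k where k: "\<And>j. j \<noteq> k \<Longrightarrow> \<bar>g j y - g j z\<bar> \<le> e j * dist y z"
      using all_but_one_flat by blast
    have rest: "\<bar>superposition (A - {k}) y - superposition (A - {k}) z\<bar> \<le> suminf e * dist y z"
      using k by (intro superposition_flat) auto
    have "\<bar>g k y - g k z\<bar> \<le> \<bar>C\<bar> * dist y z"
      using Lip[of k y z] by (smt (verit) mult_right_mono zero_le_dist)
    then show ?thesis
      using rest superposition_remove[of k A] by (cases "k \<in> A") (auto simp: distrib_right)
  qed
  then show ?thesis
    unfolding Lipschitz_def using E
    by (intro exI[of _ "\<bar>C\<bar> + suminf e"] lipschitz_onI) (auto simp: dist_real_def)
qed

text \<open>Distances between \<open>\<delta> (Suc k)\<close> and \<open>\<rho> k\<close> avoid all the intervals \<open>[\<rho> j, \<delta> j)\<close>.\<close>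

lemma superposition_flat_in_gap:
  assumes "s \<in> S" "\<delta> (Suc k) \<le> dist x s" "dist x s < \<rho> k"
  shows "\<bar>superposition A x - superposition A s\<bar> \<le> suminf e * dist x s"
proof (intro superposition_flat flat_at_S assms(1))
  fix j
  consider "j \<le> k" | "Suc k = j" | "Suc k < j" by linarith
  then show "dist x s < \<rho> j \<or> \<delta> j \<le> dist x s"
  proof cases
    case 1
    then have "\<rho> k \<le> \<rho> j"
      using later_scale[of j k] inner_le[of k] scale_pos[of k] by (cases "j = k") auto
    with assms show ?thesis by simp
  next
    case 3
    then show ?thesis
      using later_scale[of "Suc k" j] inner_le[of "Suc k"] scale_pos[of j] assms by auto
  qed (use assms in simp)
qed

text \<open>A point at which \<open>g k\<close> is steep as seen from \<open>s\<close> cannot be closer to \<open>s\<close> than \<open>\<rho> k\<close>, as \<open>g k\<close> is flat there;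
  its distance therefore lies in \<open>[\<rho> k, \<delta> k)\<close>, which is disjoint from the corresponding
  intervals of the other indices.\<close>

lemma others_flat_at_steep:
  assumes "s \<in> S" "suminf e < \<beta>" "steep (g k) (\<delta> k) \<beta> s x" "j \<noteq> k"
  shows "\<bar>g j x - g j s\<bar> \<le> e j * dist x s"
proof (intro flat_at_S assms(1))
  have "\<rho> k \<le> dist x s"
  proof (rule ccontr)
    assume "\<not> ?thesis"
    then have "\<beta> * dist x s \<le> suminf e * dist x s"
      using flat_at_S[OF assms(1), of x k] assms(3) mult_right_mono[OF e_le_suminf[of k], of "dist x s"]
      unfolding steep_def by linarith
    then show False using assms(2,3) by (auto simp: steep_def dest: mult_right_le_imp_le)
  qed
  then show "dist x s < \<rho> j \<or> \<delta> j \<le> dist x s"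
    using assms(3,4) later_scale[of j k] later_scale[of k j] scale_pos[of j] scale_pos[of k]
    by (cases "j < k") (auto simp: steep_def)
qed

lemma superposition_at_steep:
  assumes "s \<in> S" "suminf e < \<beta>" "steep (g k) (\<delta> k) \<beta> s x"
  shows "k \<notin> A \<Longrightarrow> \<bar>superposition A x - superposition A s\<bar> \<le> suminf e * dist x s"
    and "k \<in> A \<Longrightarrow> (\<beta> - suminf e) * dist x s \<le> \<bar>superposition A x - superposition A s\<bar>"
proof -
  have rest: "\<bar>superposition (A - {k}) x - superposition (A - {k}) s\<bar> \<le> suminf e * dist x s"
    using others_flat_at_steep[OF assms] by (intro superposition_flat) auto
  then show "k \<notin> A \<Longrightarrow> \<bar>superposition A x - superposition A s\<bar> \<le> suminf e * dist x s" by simp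
  assume "k \<in> A"
  then show "(\<beta> - suminf e) * dist x s \<le> \<bar>superposition A x - superposition A s\<bar>"
    using rest superposition_remove[of k A x] superposition_remove[of k A s] assms(3)
    unfolding steep_def left_diff_distrib by linarith
qed

end


section \<open>Construction of a lacunary family\<close>

text \<open>The recursion behind the construction: the scale \<open>\<delta> k\<close> determines the index \<open>m k\<close>, this
  determines the inner scale \<open>\<rho> k\<close>, and \<open>\<rho> k\<close> bounds the next outer scale, where \<open>r\<close> allows
  an arbitrarily long gap to be prescribed.\<close>

lemma choose_scales:
  fixes flat_radius :: "nat \<Rightarrow> real" and r :: "real \<Rightarrow> real" and Q :: "nat \<Rightarrow> real \<Rightarrow> nat \<Rightarrow> bool"
  assumes Q: "\<And>k d. 0 < d \<Longrightarrow> \<exists>m. Q k d m"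
    and flat_radius: "\<And>k d m. Q k d m \<Longrightarrow> 0 < flat_radius m"
    and r: "\<And>t. 0 < t \<Longrightarrow> 0 < r t"
  obtains m \<delta> \<rho> where
    "\<And>k. Q k (\<delta> k) (m k)" "\<And>k. 0 < \<rho> k" "\<And>k. \<rho> k \<le> flat_radius (m k)" "\<And>k. \<rho> k \<le> \<delta> k"
    "\<And>k. 2 * \<delta> (Suc k) \<le> \<rho> k" "\<And>k. \<delta> (Suc k) \<le> r (\<rho> k)"
proof -
  define M where "M k d = (SOME m. Q k d m)" for k d
  define R where "R k d = min (flat_radius (M k d)) d" for k d
  define \<delta> where "\<delta> = rec_nat 1 (\<lambda>k d. min (R k d / 2) (r (R k d)))"
  have \<delta>_Suc: "\<delta> (Suc k) = min (R k (\<delta> k) / 2) (r (R k (\<delta> k)))" for k by (simp add: \<delta>_def)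
  have M: "Q k d (M k d)" if "0 < d" for k d
    unfolding M_def using Q[OF that] by (rule someI_ex)
  then have R: "0 < R k d" if "0 < d" for k d
    using flat_radius[OF M[OF that]] that by (simp add: R_def)
  have \<delta>: "0 < \<delta> k" for k
  proof (induction k)
    case (Suc k)
    then show ?case using R r by (simp add: \<delta>_Suc)
  qed (simp add: \<delta>_def)
  show ?thesis
    by (rule that[of \<delta> "\<lambda>k. M k (\<delta> k)" "\<lambda>k. R k (\<delta> k)"])
      (use M R \<delta> in \<open>auto simp: \<delta>_Suc R_def\<close>)
qed

text \<open>The function \<open>g k\<close> is the minimum of a folded \<open>f (m k)\<close> and the cutoff
  \<open>e k * max 0 (\<delta> k - infdist x S)\<close>.  A minimum, unlike a product, inherits all the Lipschitz bounds of its
  arguments without loss, and the cutoff by itself bounds \<open>g k\<close> by \<open>e k * \<delta> k\<close> and confines its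
  support.  It does not interfere near \<open>S\<close>: folding has amplitude at most \<open>e k * \<delta> k / 2\<close>, below the value
  of the cutoff within \<open>\<delta> k / 2\<close> of \<open>S\<close>, which is where the oscillation of \<open>f (m k)\<close> takes place.\<close>

lemma exists_lacunary_family:
  fixes M :: "'a :: polish_space measure" and f :: "nat \<Rightarrow> 'a \<Rightarrow> real" and r :: "real \<Rightarrow> real"
  assumes M: "finite_measure M" "sets M = sets borel"
    and "S \<noteq> {}" and "0 < L" and "0 < \<epsilon>" and r: "\<forall>t>0. 0 < r t"
    and Lip: "\<forall>m\<ge>1. L-lipschitz_on UNIV (f m)"
    and osc: "\<forall>s\<in>S. \<exists>k\<ge>1. \<forall>m\<ge>k. \<exists>x. 0 < dist x s \<and> dist x s < 1 / real m \<and>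
           \<bar>f m x - f m s\<bar> \<ge> \<beta> * dist x s"
    and flat: "\<forall>m\<ge>1. \<exists>\<rho>>0. \<forall>s\<in>S. \<forall>y\<in>ball s \<rho>. \<forall>z\<in>ball s \<rho>.
           \<bar>f m y - f m z\<bar> \<le> dist y z / real m"
  obtains g \<delta> \<rho> e C where
    "lacunary_family S g \<delta> \<rho> e C" "suminf e = \<epsilon>" "\<And>k. \<delta> (Suc k) \<le> r (\<rho> k)"
    "AE s in M. s \<in> S \<longrightarrow> (\<forall>\<^sub>F k in sequentially. \<exists>x. steep (g k) (\<delta> k) \<beta> s x)"
proof -
  interpret finite_measure M by fact
  define e where "e k = \<epsilon> * (1 / 2) ^ Suc k" for k :: nat
  have e_pos: "0 < e k" for k using assms by (simp add: e_def)
  have e_sums: "e sums \<epsilon>"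
    unfolding e_def using sums_mult[OF power_half_series, of \<epsilon>] by simp
  obtain flat_radius where flat_radius: "\<And>m. 1 \<le> m \<Longrightarrow> 0 < flat_radius m"
    "\<And>m s y z. 1 \<le> m \<Longrightarrow> s \<in> S \<Longrightarrow> y \<in> ball s (flat_radius m) \<Longrightarrow> z \<in> ball s (flat_radius m)
      \<Longrightarrow> \<bar>f m y - f m z\<bar> \<le> dist y z / m"
    using flat by metis
  (* The wave at level k has 2 ^ k possible shifts, spaced by u = 2 * L / m, so that its amplitude
     is 2 ^ k * u; the oscillation of f m at distance below 1 / m is less than u / 2 = L / m. *)
  define Q where "Q k d m \<longleftrightarrow> 1 \<le> m \<and> k \<le> m \<and> 1 / real m < e k \<and> 1 / real m < d / 2 \<and>
    (2 ^ k * 2 * L) / real m < e k * d / 2" for k d and m :: nat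
  have ex_Q: "\<exists>m. Q k d m" if "0 < d" for k d
  proof -
    have "\<forall>\<^sub>F m in sequentially. Q k d m"
      unfolding Q_def using that e_pos[of k]
      by (intro eventually_conj eventually_ge_at_top order_tendstoD(2)[OF lim_const_over_n]) auto
    then show ?thesis by (rule eventually_happens'[OF sequentially_bot])
  qed
  have flat_radius_pos: "0 < flat_radius m" if "Q k d m" for k d m
    using that flat_radius(1) by (simp add: Q_def)
  obtain m \<delta> \<rho> where Q: "\<And>k. Q k (\<delta> k) (m k)"
    and \<rho>: "\<And>k. 0 < \<rho> k" "\<And>k. \<rho> k \<le> flat_radius (m k)" "\<And>k. \<rho> k \<le> \<delta> k"
    and \<delta>: "\<And>k. 2 * \<delta> (Suc k) \<le> \<rho> k" "\<And>k. \<delta> (Suc k) \<le> r (\<rho> k)"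
    by (rule choose_scales[where Q = Q and flat_radius = flat_radius and r = r]) (assumption | rule ex_Q flat_radius_pos r[rule_format] that)+
  define u where "u k = 2 * L / m k" for k
  have m: "1 \<le> m k" "k \<le> m k" "1 / m k \<le> e k" "1 / m k < \<delta> k / 2" "2 ^ k * u k \<le> e k * (\<delta> k / 2)" for k
    using Q[of k] by (auto simp: Q_def u_def)
  have u_pos: "0 < u k" for k using m(1)[of k] assms by (simp add: u_def)
  have f_Lip: "\<bar>f (m k) y - f (m k) z\<bar> \<le> L * dist y z" for k y z
    using lipschitz_onD[OF Lip[rule_format, OF m(1)[of k]], of y z] by (simp add: dist_real_def)
  have space: "space M = UNIV" using sets_eq_imp_space_eq[OF M(2)] by simp
  have f_meas: "f (m k) \<in> borel_measurable M" for k
    using borel_measurable_continuous_onI[OF lipschitz_on_continuous_on[OF Lip[rule_format, OF m(1)[of k]]]] M(2)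
    by (simp cong: measurable_cong_sets)
  define P where "P k h B \<longleftrightarrow> B \<in> sets M \<and> measure M B \<le> measure M (space M) / real (2 ^ k) \<and>
      (\<forall>x. 0 \<le> h x \<and> h x \<le> real (2 ^ k) * u k) \<and> (\<forall>x y. \<bar>h x - h y\<bar> \<le> \<bar>f (m k) x - f (m k) y\<bar>) \<and>
      (\<forall>x y. y \<notin> B \<longrightarrow> \<bar>f (m k) x - f (m k) y\<bar> < u k / 2 \<longrightarrow> \<bar>h x - h y\<bar> = \<bar>f (m k) x - f (m k) y\<bar>)"
    for k h B
  have "\<exists>h B. P k h B" for k
    by (rule fold_isometrically_off_small_set[OF M(1) f_meas[of k] u_pos[of k], of "2 ^ k"])
      (auto simp: P_def space)
  then obtain h B where P: "\<And>k. P k (h k) (B k)" by metis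
  define cut where "cut k x = e k * max 0 (\<delta> k - infdist x S)" for k x
  define g where "g k x = min (h k x) (cut k x)" for k x
  have cut_Lip: "\<bar>cut k y - cut k z\<bar> \<le> e k * dist y z" for k y z
  proof -
    have "\<bar>cut k y - cut k z\<bar> = e k * \<bar>max 0 (\<delta> k - infdist y S) - max 0 (\<delta> k - infdist z S)\<bar>"
      using e_pos[of k] by (simp add: cut_def right_diff_distrib[symmetric] abs_mult)
    also have "\<dots> \<le> e k * dist y z"
      using infdist_triangle_abs[of y S z] e_pos[of k] by (intro mult_left_mono) linarith+
    finally show ?thesis .
  qed
  have h: "0 \<le> h k x" "h k x \<le> e k * (\<delta> k / 2)" "\<bar>h k y - h k z\<bar> \<le> \<bar>f (m k) y - f (m k) z\<bar>" for k x y z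
    using P[of k] order_trans[OF _ m(5)[of k]] by (auto simp: P_def)
  have g_diff: "\<bar>g k y - g k z\<bar> \<le> max \<bar>h k y - h k z\<bar> \<bar>cut k y - cut k z\<bar>" for k y z
    unfolding g_def by linarith
  have family: "lacunary_family S g \<delta> \<rho> e (L + \<epsilon>)"
  proof
    fix k :: nat and x y z s :: 'a
    show "0 < \<rho> k" "\<rho> k \<le> \<delta> k" "2 * \<delta> (Suc k) \<le> \<rho> k" by (fact \<rho> \<delta>)+
    show "0 \<le> e k" "summable e" using e_pos[of k] e_sums by (auto simp: sums_iff)
    show "0 \<le> g k x" using h(1) e_pos[of k] by (simp add: g_def cut_def)
    have "0 < \<delta> k" using \<rho>(1,3)[of k] by linarith
    then have "max 0 (\<delta> k - infdist x S) \<le> \<delta> k" using infdist_nonneg[of x S] by simp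
    then have "cut k x \<le> e k * \<delta> k"
      unfolding cut_def using e_pos[of k] by (intro mult_left_mono) auto
    then show "g k x \<le> e k * \<delta> k" by (simp add: g_def)
    show "\<exists>s\<in>S. dist x s < \<delta> k" if "g k x \<noteq> 0"
    proof (rule ccontr)
      assume "\<not> ?thesis"
      then have "\<delta> k \<le> infdist x S"
        using \<open>S \<noteq> {}\<close> by (auto simp: infdist_notempty not_less intro!: cINF_greatest)
      then show False using that h(1)[of k x] by (simp add: g_def cut_def)
    qed
    have "e k \<le> \<epsilon>"
      using \<open>0 < \<epsilon>\<close> power_le_one[of "1 / 2 :: real" "Suc k"] unfolding e_def by (intro mult_left_le) auto
    then have "e k * dist y z \<le> \<epsilon> * dist y z" by (intro mult_right_mono) auto
    moreover have "0 \<le> L * dist y z" "0 \<le> \<epsilon> * dist y z" using \<open>0 < L\<close> \<open>0 < \<epsilon>\<close> by auto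
    ultimately show "\<bar>g k y - g k z\<bar> \<le> (L + \<epsilon>) * dist y z"
      using g_diff[of k y z] h(3)[of k y z] f_Lip[of k y z] cut_Lip[of k y z]
      unfolding distrib_right by linarith
    assume "s \<in> S" "y \<in> ball s (\<rho> k)" "z \<in> ball s (\<rho> k)"
    then have "\<bar>f (m k) y - f (m k) z\<bar> \<le> dist y z / m k"
      using \<rho>(2)[of k] by (intro flat_radius(2) m(1)) auto
    also have "\<dots> \<le> e k * dist y z"
      using mult_right_mono[OF m(3)[of k], of "dist y z"] by simp
    finally show "\<bar>g k y - g k z\<bar> \<le> e k * dist y z"
      using g_diff[of k y z] h(3)[of k y z] cut_Lip[of k y z] by linarith
  qed
  have eventually_isometric: "AE s in M. \<forall>\<^sub>F k in sequentially. s \<in> space M - B k"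
  proof (rule borel_cantelli_AE1)
    show "B k \<in> sets M" "emeasure M (B k) < \<infinity>" for k
      using P[of k] by (auto simp: P_def less_top[symmetric])
    show "summable (\<lambda>k. measure M (B k))"
    proof (rule summable_comparison_test)
      show "summable (\<lambda>k. measure M (space M) * (1 / 2) ^ k)"
        by (intro summable_mult summable_geometric) simp
      show "\<exists>N. \<forall>k\<ge>N. norm (measure M (B k)) \<le> measure M (space M) * (1 / 2) ^ k"
        using P by (auto simp: P_def power_divide)
    qed
  qed
  have eventually_steep: "\<forall>\<^sub>F k in sequentially. \<exists>x. steep (g k) (\<delta> k) \<beta> s x"
    if s: "s \<in> S" and fold: "\<forall>\<^sub>F k in sequentially. s \<in> space M - B k" for s
  proof -
    obtain k0 where k0: "\<And>m. m \<ge> k0 \<Longrightarrow> \<exists>x. 0 < dist x s \<and> dist x s < 1 / real m \<and>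
           \<bar>f m x - f m s\<bar> \<ge> \<beta> * dist x s"
      using osc s by blast
    from fold eventually_ge_at_top[of k0] show ?thesis
    proof eventually_elim
      case (elim k)
      then obtain x where x: "0 < dist x s" "dist x s < 1 / m k" "\<bar>f (m k) x - f (m k) s\<bar> \<ge> \<beta> * dist x s"
        using k0[of "m k"] m(2)[of k] by auto
      have "L * dist x s < L * (1 / m k)" using x(2) \<open>0 < L\<close> by (rule mult_strict_left_mono)
      then have "\<bar>f (m k) x - f (m k) s\<bar> < u k / 2" using f_Lip[of k x s] by (simp add: u_def)
      then have iso: "\<bar>h k x - h k s\<bar> = \<bar>f (m k) x - f (m k) s\<bar>" using P[of k] elim by (auto simp: P_def)
      have uncut: "g k y = h k y" if "infdist y S \<le> \<delta> k / 2" for y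
      proof -
        have "e k * (\<delta> k / 2) \<le> cut k y"
          unfolding cut_def using that e_pos[of k] by (intro mult_left_mono) linarith+
        then show ?thesis using h(2)[of k y] by (simp add: g_def)
      qed
      have near: "dist x s < \<delta> k / 2" using x(2) m(4)[of k] by linarith
      then have "0 \<le> \<delta> k" using zero_le_dist[of x s] by linarith
      then have "g k x = h k x" "g k s = h k s"
        using near s by (intro uncut infdist_le2[OF s]; simp)+
      then have "steep (g k) (\<delta> k) \<beta> s x"
        using x near \<open>0 \<le> \<delta> k\<close> iso unfolding steep_def by auto
      then show ?case ..
    qed
  qed
  have "AE s in M. s \<in> S \<longrightarrow> (\<forall>\<^sub>F k in sequentially. \<exists>x. steep (g k) (\<delta> k) \<beta> s x)"
    using eventually_isometric by eventually_elim (use eventually_steep in blast)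
  then show ?thesis
    using that[OF family _ \<delta>(2)] e_sums by (simp add: sums_iff)
qed


section \<open>Nondifferentiability\<close>

lemma differentiable_wrt_approx:
  assumes "differentiable_wrt n U \<phi> F s"
  obtains D where "\<And>\<eta>. 0 < \<eta> \<Longrightarrow> \<exists>\<tau>>0. \<forall>x. 0 < dist x s \<longrightarrow> dist x s < \<tau> \<longrightarrow>
    \<bar>F x - F s - dotn n D (diffn (\<phi> x) (\<phi> s))\<bar> \<le> \<eta> * dist x s"
proof -
  obtain D where D: "Limsup (at s)
      (\<lambda>x. ereal (\<bar>F x - F s - dotn n D (diffn (\<phi> x) (\<phi> s))\<bar> / dist x s)) = 0"
    using assms unfolding differentiable_wrt_def by blast
  show ?thesis
  proof (rule that)
    fix \<eta> :: real assume "0 < \<eta>"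
    then have "\<forall>\<^sub>F x in at s. ereal (\<bar>F x - F s - dotn n D (diffn (\<phi> x) (\<phi> s))\<bar> / dist x s) < ereal \<eta>"
      by (intro Limsup_lessD) (simp add: D)
    then obtain \<tau> where "0 < \<tau>" "\<And>x. x \<noteq> s \<Longrightarrow> dist x s < \<tau> \<Longrightarrow>
        \<bar>F x - F s - dotn n D (diffn (\<phi> x) (\<phi> s))\<bar> / dist x s < \<eta>"
      by (auto simp: eventually_at)
    then show "\<exists>\<tau>>0. \<forall>x. 0 < dist x s \<longrightarrow> dist x s < \<tau> \<longrightarrow>
        \<bar>F x - F s - dotn n D (diffn (\<phi> x) (\<phi> s))\<bar> \<le> \<eta> * dist x s"
      by (intro exI[of _ \<tau>]) (auto simp: pos_divide_less_eq less_imp_le)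
  qed
qed

lemma abs_dotn_le: "\<bar>dotn n v w\<bar> \<le> normn n v * normn n w"
proof -
  have "\<bar>dotn n v w\<bar> \<le> (\<Sum>i<n. \<bar>v i\<bar> * \<bar>w i\<bar>)"
    unfolding dotn_def abs_mult[symmetric] by (rule sum_abs)
  also have "\<dots> \<le> normn n v * normn n w"
    unfolding normn_def by (rule L2_set_mult_ineq)
  finally show ?thesis .
qed

text \<open>The pointwise form in which a structured chart bounds derivatives from above: a vector \<open>D\<close> with
  large norm produces a large increment of \<open>D \<cdot> \<phi>\<close> at some point of the annulus around \<open>s\<close>.\<close>

definition detects_directions ::
    "nat \<Rightarrow> ('a :: metric_space \<Rightarrow> nat \<Rightarrow> real) \<Rightarrow> real \<Rightarrow> real \<Rightarrow> real \<Rightarrow> 'a \<Rightarrow> bool" where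
  "detects_directions n \<phi> \<kappa> r R s \<longleftrightarrow> (\<forall>v. normn n v = 1 \<longrightarrow>
     (\<exists>x. r < dist x s \<and> dist x s < R \<and> \<kappa> * dist x s \<le> \<bar>dotn n v (diffn (\<phi> x) (\<phi> s))\<bar>))"

lemma detects_directions_mono:
  "detects_directions n \<phi> \<kappa> r R s \<Longrightarrow> r' \<le> r \<Longrightarrow> detects_directions n \<phi> \<kappa> r' R s"
  unfolding detects_directions_def by (meson le_less_trans)

lemma dotn_commute: "dotn n v w = dotn n w v"
  by (simp add: dotn_def mult.commute)

lemma detects_directions_if_max:
  assumes x: "\<forall>i<n. r < dist (x i) s \<and> dist (x i) s < R"
    and max: "\<forall>v. normn n v = 1 \<longrightarrow>
      (MAX i\<in>{..<n}. \<bar>dotn n (diffn (\<phi> (x i)) (\<phi> s)) v\<bar> / dist (x i) s) \<ge> \<kappa>"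
    and "0 < r"
  shows "detects_directions n \<phi> \<kappa> r R s"
  unfolding detects_directions_def
proof (intro allI impI)
  fix v assume v: "normn n v = 1"
  then have "n \<noteq> 0" by (cases n) (auto simp: normn_def)
  let ?q = "\<lambda>i. \<bar>dotn n (diffn (\<phi> (x i)) (\<phi> s)) v\<bar> / dist (x i) s"
  have "Max (?q ` {..<n}) \<in> ?q ` {..<n}" using \<open>n \<noteq> 0\<close> by (intro Max_in) auto
  then obtain i where i: "i < n" "\<kappa> \<le> ?q i" using max v by auto
  have "r < dist (x i) s" "dist (x i) s < R" using x i(1) by auto
  moreover from this have "0 < dist (x i) s" using \<open>0 < r\<close> by linarith
  ultimately show "\<exists>x. r < dist x s \<and> dist x s < R \<and> \<kappa> * dist x s \<le> \<bar>dotn n v (diffn (\<phi> x) (\<phi> s))\<bar>"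
    using i(2) by (intro exI[of _ "x i"]) (simp add: field_simps dotn_commute)
qed

lemma detects_directions_scaled:
  assumes "detects_directions n \<phi> \<kappa> r R s" and "0 < normn n D"
  obtains x where "r < dist x s" "dist x s < R"
    "\<kappa> * normn n D * dist x s \<le> \<bar>dotn n D (diffn (\<phi> x) (\<phi> s))\<bar>"
proof -
  define v where "v j = D j / normn n D" for j
  have "normn n v = (1 / normn n D) * normn n D"
    using L2_set_right_distrib[of "1 / normn n D" D "{..<n}"] assms(2)
    unfolding normn_def v_def by simp
  then have "normn n v = 1" using assms(2) by simp
  then obtain x where x: "r < dist x s" "dist x s < R" "\<kappa> * dist x s \<le> \<bar>dotn n v (diffn (\<phi> x) (\<phi> s))\<bar>"
    using assms(1) unfolding detects_directions_def by blast
  have "dotn n v (diffn (\<phi> x) (\<phi> s)) = dotn n D (diffn (\<phi> x) (\<phi> s)) / normn n D"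
    unfolding dotn_def v_def sum_divide_distrib by simp
  then have "\<kappa> * normn n D * dist x s \<le> \<bar>dotn n D (diffn (\<phi> x) (\<phi> s))\<bar>"
    using mult_left_mono[OF x(3), of "normn n D"] assms(2) by (simp add: ac_simps)
  with x(1,2) show ?thesis by (rule that)
qed

text \<open>The inner radius \<open>r R\<close> of the annulus is uniform over \<open>U'\<close>, which is what allows the scales of a
  lacunary family to be adapted to the chart at all points simultaneously.\<close>

lemma structured_chart_detects_directions:
  fixes \<phi> :: "'a :: metric_space \<Rightarrow> nat \<Rightarrow> real"
  assumes "structured_chart M n U \<phi>"
  obtains \<kappa> U' r where "0 < \<kappa>" "AE x in M. x \<in> U \<longrightarrow> x \<in> U'" "\<forall>R>0. 0 < r R"
    "\<And>R s. 0 < R \<Longrightarrow> s \<in> U' \<Longrightarrow> detects_directions n \<phi> \<kappa> (r R) R s"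
proof -
  obtain \<kappa> where chart: "lambda_structured_chart M \<kappa> n U \<phi>"
    using assms unfolding structured_chart_def by blast
  then obtain U' where \<kappa>: "0 < \<kappa>" and U': "AE x in M. x \<in> U \<longrightarrow> x \<in> U'"
    and points: "\<forall>R>0. \<exists>r>0. \<forall>x0\<in>U'. \<exists>x :: nat \<Rightarrow> 'a.
           (\<forall>i<n. x i \<in> U \<and> r < dist (x i) x0 \<and> dist (x i) x0 < R) \<and>
           (\<forall>v. normn n v = 1 \<longrightarrow>
              (MAX i\<in>{..<n}. \<bar>dotn n (diffn (\<phi> (x i)) (\<phi> x0)) v\<bar> / dist (x i) x0) \<ge> \<kappa>)"
    unfolding lambda_structured_chart_def by blast
  have "\<exists>r. 0 < R \<longrightarrow> 0 < r \<and> (\<forall>s\<in>U'. detects_directions n \<phi> \<kappa> r R s)" for R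
  proof (cases "0 < R")
    case True
    then obtain r where r: "0 < r" "\<forall>x0\<in>U'. \<exists>x :: nat \<Rightarrow> 'a.
           (\<forall>i<n. x i \<in> U \<and> r < dist (x i) x0 \<and> dist (x i) x0 < R) \<and>
           (\<forall>v. normn n v = 1 \<longrightarrow>
              (MAX i\<in>{..<n}. \<bar>dotn n (diffn (\<phi> (x i)) (\<phi> x0)) v\<bar> / dist (x i) x0) \<ge> \<kappa>)"
      using points by blast
    have "detects_directions n \<phi> \<kappa> r R s" if "s \<in> U'" for s
      using bspec[OF r(2) that]
    proof (elim exE conjE)
      fix x :: "nat \<Rightarrow> 'a"
      assume "\<forall>i<n. x i \<in> U \<and> r < dist (x i) s \<and> dist (x i) s < R"
        and max: "\<forall>v. normn n v = 1 \<longrightarrow>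
              (MAX i\<in>{..<n}. \<bar>dotn n (diffn (\<phi> (x i)) (\<phi> s)) v\<bar> / dist (x i) s) \<ge> \<kappa>"
      then have "\<forall>i<n. r < dist (x i) s \<and> dist (x i) s < R" by simp
      from detects_directions_if_max[OF this max r(1)] show ?thesis .
    qed
    with r(1) show ?thesis by blast
  qed simp
  then obtain r where "\<And>R. 0 < R \<longrightarrow> 0 < r R \<and> (\<forall>s\<in>U'. detects_directions n \<phi> \<kappa> (r R) R s)"
    by metis
  then show ?thesis using that[OF \<kappa> U', of r] by blast
qed

context lacunary_family
begin

text \<open>Writing \<open>\<epsilon>\<close> for \<open>\<Sum>k. e k\<close>, a point in a gap that detects the direction of a derivative \<open>D\<close> gives
  \<open>\<kappa> * \<parallel>D\<parallel> \<le> 2 * \<epsilon>\<close>: one \<open>\<epsilon>\<close> bounds the slope of the sum, the other one the error of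
  the linear approximation.  At a steep point the slope is at least \<open>\<beta> - \<epsilon>\<close> and at most
  \<open>Lp * \<parallel>D\<parallel> + \<epsilon>\<close>.\<close>

lemma not_differentiable_at_structured_point:
  assumes s: "s \<in> S"
    and steep: "\<forall>\<^sub>F k in sequentially. \<exists>x. steep (g k) (\<delta> k) \<beta> s x"
    and \<phi>: "\<And>x y. normn n (diffn (\<phi> x) (\<phi> y)) \<le> Lp * dist x y" and "0 \<le> Lp"
    and detects: "\<And>k. detects_directions n \<phi> \<kappa> (\<delta> (Suc k)) (\<rho> k) s"
    and "0 < \<kappa>" and "0 < suminf e" and small: "2 * suminf e * (1 + Lp / \<kappa>) < \<beta>"
  shows "\<not> differentiable_wrt n U \<phi> (superposition UNIV) s"
proof
  let ?F = "superposition UNIV" and ?\<epsilon> = "suminf e"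
  assume "differentiable_wrt n U \<phi> ?F s"
  then obtain D where "\<exists>\<tau>>0. \<forall>x. 0 < dist x s \<longrightarrow> dist x s < \<tau> \<longrightarrow>
      \<bar>?F x - ?F s - dotn n D (diffn (\<phi> x) (\<phi> s))\<bar> \<le> ?\<epsilon> * dist x s"
    using differentiable_wrt_approx \<open>0 < ?\<epsilon>\<close> by metis
  then obtain \<tau> where "0 < \<tau>" and D: "\<And>x. 0 < dist x s \<Longrightarrow> dist x s < \<tau> \<Longrightarrow>
      \<bar>?F x - ?F s - dotn n D (diffn (\<phi> x) (\<phi> s))\<bar> \<le> ?\<epsilon> * dist x s" by blast
  obtain K where K: "\<And>k. K \<le> k \<Longrightarrow> \<delta> k < \<tau>" using scales_vanish[OF \<open>0 < \<tau>\<close>] by blast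
  have "\<forall>\<^sub>F k in sequentially. K \<le> k \<and> (\<exists>x. steep (g k) (\<delta> k) \<beta> s x)"
    using steep eventually_ge_at_top[of K] by eventually_elim simp
  then obtain k x where k: "K \<le> k" and x: "steep (g k) (\<delta> k) \<beta> s x"
    using eventually_happens'[OF sequentially_bot] by blast
  have D_small: "normn n D \<le> 2 * ?\<epsilon> / \<kappa>"
  proof (cases "normn n D = 0")
    case False
    then have D_pos: "0 < normn n D" by (simp add: normn_def L2_set_nonneg less_le)
    obtain y where y: "\<delta> (Suc k) < dist y s" "dist y s < \<rho> k"
      and slope: "\<kappa> * normn n D * dist y s \<le> \<bar>dotn n D (diffn (\<phi> y) (\<phi> s))\<bar>"
      by (rule detects_directions_scaled[OF detects D_pos])
    have pos: "0 < dist y s" using y(1) scale_pos[of "Suc k"] by linarith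
    have "dist y s < \<tau>" using y(2) inner_le[of k] K[OF k] by linarith
    then have "\<kappa> * normn n D * dist y s \<le> 2 * ?\<epsilon> * dist y s"
      using D[OF pos] slope superposition_flat_in_gap[OF s, of k y UNIV] y by linarith
    then have "\<kappa> * normn n D \<le> 2 * ?\<epsilon>" using pos by simp
    then show ?thesis using \<open>0 < \<kappa>\<close> by (simp add: field_simps)
  qed (use \<open>0 < \<kappa>\<close> \<open>0 < ?\<epsilon>\<close> in simp)
  have x_pos: "0 < dist x s" and x_near: "dist x s < \<tau>"
    using x K[OF k] by (auto simp: steep_def)
  have "\<bar>dotn n D (diffn (\<phi> x) (\<phi> s))\<bar> \<le> normn n D * (Lp * dist x s)"
    using abs_dotn_le[of n D] mult_left_mono[OF \<phi>, of "normn n D" x s]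
    by (auto simp: normn_def L2_set_nonneg intro: order_trans)
  also have "\<dots> \<le> 2 * ?\<epsilon> / \<kappa> * (Lp * dist x s)"
    using D_small \<open>0 \<le> Lp\<close> by (intro mult_right_mono) auto
  finally have dot: "\<bar>dotn n D (diffn (\<phi> x) (\<phi> s))\<bar> \<le> 2 * ?\<epsilon> * (Lp / \<kappa>) * dist x s" by simp
  have "0 \<le> 2 * ?\<epsilon> * (Lp / \<kappa>)" using \<open>0 < \<kappa>\<close> \<open>0 < ?\<epsilon>\<close> \<open>0 \<le> Lp\<close> by simp
  then have "?\<epsilon> < \<beta>" using small \<open>0 < ?\<epsilon>\<close> by (simp add: distrib_left)
  from superposition_at_steep(2)[OF s this x, of UNIV]
  have "(\<beta> - ?\<epsilon>) * dist x s \<le> (?\<epsilon> + 2 * ?\<epsilon> * (Lp / \<kappa>)) * dist x s"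
    using D[OF x_pos x_near] dot by (simp add: distrib_right)
  then have "\<beta> - ?\<epsilon> \<le> ?\<epsilon> + 2 * ?\<epsilon> * (Lp / \<kappa>)" using x_pos by (rule mult_right_le_imp_le)
  then show False using small by (simp add: distrib_left)
qed

text \<open>The index \<open>p\<close> of a coefficient of maximal modulus in a linear relation between the derivatives
  selects the class of a steep level \<open>k\<close>.  There, with \<open>\<epsilon> = (\<Sum>k. e k)\<close>, the \<open>p\<close>-th term of
  \<open>\<Sum>i\<le>n. c i * F i\<close> has slope at least \<open>\<bar>c p\<bar> * (\<beta> - \<epsilon>)\<close>, the \<open>n\<close> other terms
  have slope at most \<open>\<bar>c p\<bar> * \<epsilon>\<close> each, and so have the \<open>n + 1\<close> errors of the linear
  approximations; this is where the bound \<open>2 * (n + 1) * \<epsilon> < \<beta>\<close> comes from.\<close>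

lemma some_residue_class_not_differentiable:
  assumes s: "s \<in> S"
    and steep: "\<forall>\<^sub>F k in sequentially. \<exists>x. steep (g k) (\<delta> k) \<beta> s x"
    and "0 < suminf e" and small: "2 * (real n + 1) * suminf e < \<beta>"
  shows "\<exists>i\<le>n. \<not> differentiable_wrt n U \<phi> (superposition {k. k mod Suc n = i}) s"
proof (rule ccontr)
  define F where "F i = superposition {k. k mod Suc n = i}" for i
  let ?\<epsilon> = "suminf e"
  assume "\<not> ?thesis"
  then have diff: "differentiable_wrt n U \<phi> (F i) s" if "i \<le> n" for i
    using that unfolding F_def by blast
  have "\<exists>D \<tau>. 0 < \<tau> \<and> (\<forall>x. 0 < dist x s \<longrightarrow> dist x s < \<tau> \<longrightarrow>
      \<bar>F i x - F i s - dotn n D (diffn (\<phi> x) (\<phi> s))\<bar> \<le> ?\<epsilon> * dist x s)" if "i \<le> n" for i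
    using differentiable_wrt_approx[OF diff[OF that]] \<open>0 < ?\<epsilon>\<close> by metis
  then obtain D \<tau> where \<tau>: "\<And>i. i \<le> n \<Longrightarrow> 0 < \<tau> i"
    and D: "\<And>i x. i \<le> n \<Longrightarrow> 0 < dist x s \<Longrightarrow> dist x s < \<tau> i \<Longrightarrow>
      \<bar>F i x - F i s - dotn n (D i) (diffn (\<phi> x) (\<phi> s))\<bar> \<le> ?\<epsilon> * dist x s"
    by metis
  obtain c where c: "\<exists>i\<in>{..n}. c i \<noteq> 0" "\<And>l. l < n \<Longrightarrow> (\<Sum>i\<le>n. c i * D i l) = 0"
    using linear_dependence[of "{..n}" n D] by auto
  have "Max ((\<lambda>i. \<bar>c i\<bar>) ` {..n}) \<in> (\<lambda>i. \<bar>c i\<bar>) ` {..n}" by (intro Max_in) auto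
  then obtain p where "p \<le> n" "Max ((\<lambda>i. \<bar>c i\<bar>) ` {..n}) = \<bar>c p\<bar>" by blast
  then have p: "p \<le> n" "\<And>i. i \<le> n \<Longrightarrow> \<bar>c i\<bar> \<le> \<bar>c p\<bar>"
    using Max_ge[of "(\<lambda>i. \<bar>c i\<bar>) ` {..n}"] by auto
  have c_pos: "0 < \<bar>c p\<bar>"
  proof -
    obtain i where "i \<le> n" "c i \<noteq> 0" using c(1) by auto
    with p(2)[of i] show ?thesis by linarith
  qed
  (* The linear parts cancel in the combination with coefficients c. *)
  have relation: "(\<Sum>i\<le>n. c i * dotn n (D i) w) = 0" for w
  proof -
    have "(\<Sum>i\<le>n. c i * dotn n (D i) w) = (\<Sum>l<n. (\<Sum>i\<le>n. c i * D i l) * w l)"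
      unfolding dotn_def sum_distrib_left sum_distrib_right by (subst sum.swap) (simp add: mult.assoc)
    then show ?thesis using c(2) by simp
  qed
  have "0 < Min (\<tau> ` {..n})" using \<tau> by simp
  then obtain K where K: "\<And>k. K \<le> k \<Longrightarrow> \<delta> k < Min (\<tau> ` {..n})" using scales_vanish by blast
  obtain K' where K': "\<And>k. K' \<le> k \<Longrightarrow> \<exists>x. steep (g k) (\<delta> k) \<beta> s x"
    using steep by (auto simp: eventually_sequentially)
  define k where "k = p + Suc n * (K + K')"
  have k: "K \<le> k" "K' \<le> k" by (auto simp: k_def)
  have k_mod: "k mod Suc n = p" using p(1) unfolding k_def mod_mult_self2 by simp
  obtain x where x: "steep (g k) (\<delta> k) \<beta> s x" using K'[OF k(2)] by blast
  define d where "d = dist x s"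
  have d: "0 < d" using x by (simp add: d_def steep_def)
  have near: "dist x s < \<tau> i" if "i \<le> n" for i
  proof -
    have "Min (\<tau> ` {..n}) \<le> \<tau> i" using that by simp
    then show ?thesis using x K[OF k(1)] unfolding steep_def by linarith
  qed
  have "?\<epsilon> \<le> (2 * (real n + 1)) * ?\<epsilon>" using \<open>0 < ?\<epsilon>\<close> by simp
  then have "?\<epsilon> < \<beta>" using small by linarith
  note at_steep = superposition_at_steep[OF s this x]
  have flat: "\<bar>c i * (F i x - F i s)\<bar> \<le> \<bar>c p\<bar> * (?\<epsilon> * d)" if "i \<in> {..n} - {p}" for i
    unfolding abs_mult F_def d_def using that p(2)[of i] k_mod
    by (intro mult_mono at_steep(1)) auto
  have remainder: "\<bar>c i * (F i x - F i s - dotn n (D i) (diffn (\<phi> x) (\<phi> s)))\<bar> \<le> \<bar>c p\<bar> * (?\<epsilon> * d)"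
    if "i \<in> {..n}" for i
    unfolding abs_mult d_def using that p(2)[of i] d D[of i x] near[of i]
    by (intro mult_mono) (auto simp: d_def)
  have "(\<Sum>i\<le>n. c i * (F i x - F i s))
      = (\<Sum>i\<le>n. c i * (F i x - F i s - dotn n (D i) (diffn (\<phi> x) (\<phi> s))))"
    using relation[of "diffn (\<phi> x) (\<phi> s)"] by (simp add: right_diff_distrib[of _ "_ - _"] sum_subtractf)
  also have "\<bar>\<dots>\<bar> \<le> (\<Sum>i\<le>n. \<bar>c p\<bar> * (?\<epsilon> * d))"
    by (rule order_trans[OF sum_abs]) (intro sum_mono remainder)
  finally have total: "\<bar>\<Sum>i\<le>n. c i * (F i x - F i s)\<bar> \<le> (real n + 1) * (\<bar>c p\<bar> * (?\<epsilon> * d))" by (simp add: add.commute)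
  have "\<bar>\<Sum>i\<in>{..n} - {p}. c i * (F i x - F i s)\<bar> \<le> (\<Sum>i\<in>{..n} - {p}. \<bar>c p\<bar> * (?\<epsilon> * d))"
    by (rule order_trans[OF sum_abs]) (intro sum_mono flat)
  then have others: "\<bar>\<Sum>i\<in>{..n} - {p}. c i * (F i x - F i s)\<bar> \<le> real n * (\<bar>c p\<bar> * (?\<epsilon> * d))"
    using p(1) by simp
  have "(\<beta> - ?\<epsilon>) * d \<le> \<bar>F p x - F p s\<bar>"
    unfolding F_def d_def using k_mod by (intro at_steep(2)) simp
  then have "\<bar>c p\<bar> * ((\<beta> - ?\<epsilon>) * d) \<le> \<bar>c p * (F p x - F p s)\<bar>"
    unfolding abs_mult by (intro mult_left_mono) auto
  moreover have "(\<Sum>i\<le>n. c i * (F i x - F i s))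
      = c p * (F p x - F p s) + (\<Sum>i\<in>{..n} - {p}. c i * (F i x - F i s))"
    using p(1) by (intro sum.remove) auto
  ultimately have "\<bar>c p\<bar> * ((\<beta> - ?\<epsilon>) * d) \<le> (real n + 1) * (\<bar>c p\<bar> * (?\<epsilon> * d)) + real n * (\<bar>c p\<bar> * (?\<epsilon> * d))"
    using total others by linarith
  then have "(\<bar>c p\<bar> * d) * \<beta> \<le> (\<bar>c p\<bar> * d) * (2 * (real n + 1) * ?\<epsilon>)"
    by (simp add: algebra_simps)
  then have "\<beta> \<le> 2 * (real n + 1) * ?\<epsilon>"
    using mult_pos_pos[OF c_pos d] by (rule mult_left_le_imp_le)
  then show False using small by simp
qed

end

theorem proposition4p3:
  fixes M :: "'a :: polish_space measure"
    and n :: nat and U S :: "'a set" and \<phi> :: "'a \<Rightarrow> nat \<Rightarrow> real"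
    and L \<beta> :: real and f :: "nat \<Rightarrow> 'a \<Rightarrow> real"
  assumes "metric_measure_space M"
    and "structured_chart M n U \<phi>"
    and "S \<subseteq> U" and "S \<in> sets borel"
    and "L > 0" and "\<beta> > 0"
    and "\<forall>m\<ge>1. L-lipschitz_on UNIV (f m)"
    and "\<forall>x0\<in>S. \<exists>k\<ge>1. \<forall>m\<ge>k. \<exists>x. 0 < dist x x0 \<and> dist x x0 < 1 / real m \<and>
           \<bar>f m x - f m x0\<bar> \<ge> \<beta> * dist x x0"
    and "\<forall>m\<ge>1. \<exists>\<rho>>0. \<forall>x0\<in>S. \<forall>y\<in>ball x0 \<rho>. \<forall>z\<in>ball x0 \<rho>.
           \<bar>f m y - f m z\<bar> \<le> dist y z / real m"
  shows "(\<exists>F :: 'a \<Rightarrow> real. Lipschitz F \<and>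
            (AE x in M. x \<in> S \<longrightarrow> \<not> differentiable_wrt n U \<phi> F x)) \<and>
         (lipschitz_differentiability_space M \<longrightarrow> S \<in> null_sets M)"
proof (cases "S = {}")
  case True
  then show ?thesis
    by (auto simp: Lipschitz_def intro!: exI[of _ "\<lambda>_. 0"] exI[of _ 0] lipschitz_onI)
next
  case False
  interpret metric_measure_space M by fact
  have M: "finite_measure M" by unfold_locales
  obtain \<kappa> U' r where \<kappa>: "0 < \<kappa>" and U': "AE x in M. x \<in> U \<longrightarrow> x \<in> U'" and r: "\<forall>R>0. 0 < r R"
    and detects: "\<And>R s. 0 < R \<Longrightarrow> s \<in> U' \<Longrightarrow> detects_directions n \<phi> \<kappa> (r R) R s"
    using assms(2) by (rule structured_chart_detects_directions) blast
  obtain Lp where Lp: "0 \<le> Lp" "\<And>x y. normn n (diffn (\<phi> x) (\<phi> y)) \<le> Lp * dist x y"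
    using assms(2) unfolding structured_chart_def lambda_structured_chart_def Lipschitzn_def by blast
  have "\<exists>F :: 'a \<Rightarrow> real. Lipschitz F \<and> (AE x in M. x \<in> S \<longrightarrow> \<not> differentiable_wrt n U \<phi> F x)"
  proof -
    define c where "c = 1 + Lp / \<kappa>"
    define \<epsilon> where "\<epsilon> = \<beta> / (4 * c)"
    have "0 < c" using \<kappa> Lp(1) by (simp add: c_def add_pos_nonneg)
    then have \<epsilon>: "0 < \<epsilon>" "2 * \<epsilon> * (1 + Lp / \<kappa>) < \<beta>"
      using \<open>\<beta> > 0\<close> by (simp_all add: \<epsilon>_def c_def[symmetric])
    obtain g \<delta> \<rho> e C where family: "lacunary_family S g \<delta> \<rho> e C" "suminf e = \<epsilon>"
      and gap: "\<And>k. \<delta> (Suc k) \<le> r (\<rho> k)"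
      and steep: "AE s in M. s \<in> S \<longrightarrow> (\<forall>\<^sub>F k in sequentially. \<exists>x. steep (g k) (\<delta> k) \<beta> s x)"
      by (rule exists_lacunary_family[OF M sets_eq_borel False assms(5) \<epsilon>(1) r assms(7-9)]) blast
    interpret lacunary_family S g \<delta> \<rho> e C by fact
    have "AE s in M. s \<in> S \<longrightarrow> \<not> differentiable_wrt n U \<phi> (superposition UNIV) s"
      using steep U'
    proof eventually_elim
      case (elim s)
      show ?case
      proof
        assume s: "s \<in> S"
        then have "s \<in> U'" using elim(2) assms(3) by blast
        show "\<not> differentiable_wrt n U \<phi> (superposition UNIV) s"
        proof (rule not_differentiable_at_structured_point[OF s _ Lp(2) Lp(1) _ \<kappa>])
          show "\<forall>\<^sub>F k in sequentially. \<exists>x. steep (g k) (\<delta> k) \<beta> s x" using elim(1) s by blast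
          show "detects_directions n \<phi> \<kappa> (\<delta> (Suc k)) (\<rho> k) s" for k
            using detects_directions_mono[OF detects[OF inner_pos \<open>s \<in> U'\<close>] gap] .
        qed (use family(2) \<epsilon> in auto)
      qed
    qed
    with superposition_Lipschitz show ?thesis by blast
  qed
  moreover have "S \<in> null_sets M" if lds: "lipschitz_differentiability_space M"
  proof -
    obtain n' U' and \<phi>' :: "nat \<Rightarrow> 'a \<Rightarrow> nat \<Rightarrow> real" where cover: "(\<Union>j. U' j) = (UNIV :: 'a set)"
      and diff: "\<And>F j. Lipschitz F \<Longrightarrow> AE x in M. x \<in> U' j \<longrightarrow> differentiable_wrt (n' j) (U' j) (\<phi>' j) F x"
      using lds unfolding lipschitz_differentiability_space_def by blast
    (* The family depends on j: the admissible size of the sum of the e k depends on the dimension. *)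
    have "AE s in M. s \<in> U' j \<longrightarrow> s \<notin> S" for j
    proof -
      define c where "c = real (n' j) + 1"
      define \<epsilon> where "\<epsilon> = \<beta> / (4 * c)"
      have "0 < c" by (simp add: c_def)
      then have \<epsilon>: "0 < \<epsilon>" "2 * (real (n' j) + 1) * \<epsilon> < \<beta>"
        using \<open>\<beta> > 0\<close> by (simp_all add: \<epsilon>_def c_def[symmetric])
      obtain g \<delta> \<rho> e C where family: "lacunary_family S g \<delta> \<rho> e C" "suminf e = \<epsilon>"
        and steep: "AE s in M. s \<in> S \<longrightarrow> (\<forall>\<^sub>F k in sequentially. \<exists>x. steep (g k) (\<delta> k) \<beta> s x)"
        by (rule exists_lacunary_family[OF M sets_eq_borel False assms(5) \<epsilon>(1) r assms(7-9)]) blast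
      interpret lacunary_family S g \<delta> \<rho> e C by fact
      have "AE s in M. \<forall>i\<le>n' j. s \<in> U' j \<longrightarrow>
          differentiable_wrt (n' j) (U' j) (\<phi>' j) (superposition {k. k mod Suc (n' j) = i}) s"
        using diff[OF superposition_Lipschitz] by (simp add: AE_all_countable)
      with steep show ?thesis
      proof eventually_elim
        case (elim s)
        then show ?case
          using some_residue_class_not_differentiable[of s \<beta> "n' j" "U' j" "\<phi>' j"] family(2) \<epsilon> by auto
      qed
    qed
    then have "AE s in M. \<forall>j. s \<in> U' j \<longrightarrow> s \<notin> S" unfolding AE_all_countable by blast
    then have "AE s in M. s \<notin> S" using cover by (auto elim!: eventually_mono)
    moreover have "S \<in> sets M" using assms(4) sets_eq_borel by simp
    ultimately show ?thesis by (simp add: AE_iff_null_sets)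
  qed
  ultimately show ?thesis by blast
qed

end
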